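(* Let $\mathbb{H}$ be a complex separable Hilbert space, let $\{P_n\}$ be orthogonal projections on $\mathbb{H}$ with $\dim P_n(\mathbb{H})=n$ and $P_nx\to x$ for every $x\in\mathbb{H}$, and for each $n$ let $\tilde U_n$ be a unitary $n\times n$ matrix (acting on the range of $P_n$). For $A\in\mathbb{B}(\mathbb{H})$ put $A_n=P_nAP_n$ and $\Phi_n(A)=P_{\tilde U_n}(A_n)$, and let $\Phi$ be any limit point of the sequence $\{\Phi_n\}$ in Kadison's BW topology. Let $A\in\mathbb{B}(\mathbb{H})$ be self-adjoint and suppose that $P_{\tilde U_n}(A_n)$ converges to $A_n$ in uniform cluster. Then $A-\Phi(A)$ has finite rank.
   Context: $A_n=P_nAP_n$ is regarded as an $n\times n$ matrix by restriction to the range of $P_n$ (with a fixed orthonormal basis); conversely an $n\times n$ matrix is regarded as an operator on $\mathbb{H}$ that vanishes on the orthogonal complement of the range of $P_n$. For a unitary $n\times n$ matrix $\tilde U_n$, let $M_{\tilde U_n}=\{X\in M_n(\mathbb{C}): \tilde U_n^*X\tilde U_n \text{ is diagonal}\}$. For $X\in M_n(\mathbb{C})$, $P_{\tilde U_n}(X)$ is the unique element of $M_{\tilde U_n}$ closest to $X$ in Frobenius norm; explicitly $P_{\tilde U_n}(X)=\tilde U_n\,\sigma(\tilde U_n^*X\tilde U_n)\,\tilde U_n^*$, where $\sigma(Y)$ is the diagonal matrix with the same diagonal entries as $Y$. Each $\Phi_n$ is a completely positive map on $\mathbb{B}(\mathbb{H})$ with $\Phi_n(I)\le I$. BW topology: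 a net $\Psi_\alpha$ in the set of completely positive maps $\Psi$ on $\mathbb{B}(\mathbb{H})$ with $\Psi(I)\le I$ converges to $\Psi$ iff $\Psi_\alpha(T)\to\Psi(T)$ in the weak operator topology for every $T\in\mathbb{B}(\mathbb{H})$; this set is compact. A limit point of $\{\Phi_n\}$ is the limit of some convergent subnet of $\{\Phi_n\}$. Uniform cluster: for sequences $\{X_n\},\{Y_n\}$ of Hermitian $n\times n$ matrices, $X_n$ converges to $Y_n$ in uniform cluster if there is an integer $N$ (independent of $\epsilon$ and $n$) such that for every $\epsilon>0$ there is an integer $N_{2,\epsilon}$ such that for all $n>N_{2,\epsilon}$ all singular values of $X_n-Y_n$ lie in $[0,\epsilon)$ except for at most $N$ of them (with multiplicity). *)

theory Defs
  imports "HOL-Analysis.Analysis" "Jordan_Normal_Form.Schur_Decomposition"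
    "Jordan_Normal_Form.Char_Poly"
begin

section \<open>Complex Hilbert spaces\<close>

text \<open>The library has only real inner product spaces. A complex Hilbert space is a
  complete real inner product space that carries a compatible complex scalar multiplication
  and a sesquilinear inner product (antilinear in the first argument) whose real part is the
  real inner product; in particular both induce the same norm.\<close>

class complex_hilbert_space = real_inner + complete_space +
  fixes scaleC :: "complex \<Rightarrow> 'a \<Rightarrow> 'a" (infixr "*\<^sub>C" 75)
    and cinner :: "'a \<Rightarrow> 'a \<Rightarrow> complex"
  assumes scaleC_add_right: "c *\<^sub>C (x + y) = c *\<^sub>C x + c *\<^sub>C y"
    and scaleC_add_left: "(c + d) *\<^sub>C x = c *\<^sub>C x + d *\<^sub>C x"
    and scaleC_scaleC: "c *\<^sub>C d *\<^sub>C x = (c * d) *\<^sub>C x"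
    and scaleC_of_real: "complex_of_real r *\<^sub>C x = scaleR r x"
    and cinner_commute: "cinner x y = cnj (cinner y x)"
    and cinner_add_right: "cinner x (y + z) = cinner x y + cinner x z"
    and cinner_scaleC_right: "cinner x (c *\<^sub>C y) = c * cinner x y"
    and Re_cinner: "Re (cinner x y) = inner x y"

lemma scaleC_one: "1 *\<^sub>C x = (x :: 'a :: complex_hilbert_space)"
  using scaleC_of_real[of 1 x] by simp

interpretation cvs: vector_space "scaleC :: complex \<Rightarrow> 'a \<Rightarrow> 'a :: complex_hilbert_space"
  by unfold_locales
    (simp_all add: scaleC_add_right scaleC_add_left scaleC_scaleC scaleC_one)


section \<open>Operators\<close>

definition bounded_ops :: "('a::complex_hilbert_space \<Rightarrow> 'a) set" where
  "bounded_ops = {T. bounded_linear T \<and> (\<forall>c x. T (c *\<^sub>C x) = c *\<^sub>C T x)}"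

definition self_adjoint :: "('a::complex_hilbert_space \<Rightarrow> 'a) \<Rightarrow> bool" where
  "self_adjoint T \<longleftrightarrow> (\<forall>x y. cinner (T x) y = cinner x (T y))"

definition orthogonal_projection :: "('a::complex_hilbert_space \<Rightarrow> 'a) \<Rightarrow> bool" where
  "orthogonal_projection P \<longleftrightarrow> P \<in> bounded_ops \<and> P \<circ> P = P \<and> self_adjoint P"

definition finite_rank :: "('a::complex_hilbert_space \<Rightarrow> 'a) \<Rightarrow> bool" where
  "finite_rank T \<longleftrightarrow> (\<exists>B. finite B \<and> range T = cvs.span B)"


section \<open>Completely positive maps and the BW topology\<close>

text \<open>Positivity of the operator on the \<open>k\<close>-fold direct sum of the Hilbert space given by a
  \<open>k\<close> by \<open>k\<close> matrix of operators. The order on complex numbers is that of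
  \<^theory>\<open>HOL-Library.Complex_Order\<close>: \<open>0 \<le> z\<close> means that \<open>z\<close> is real and nonnegative.\<close>

definition positive_op_matrix ::
    "nat \<Rightarrow> (nat \<Rightarrow> nat \<Rightarrow> 'a::complex_hilbert_space \<Rightarrow> 'a) \<Rightarrow> bool" where
  "positive_op_matrix k T \<longleftrightarrow>
     (\<forall>x. 0 \<le> (\<Sum>i<k. \<Sum>j<k. cinner (x i) (T i j (x j))))"

definition op_le :: "('a::complex_hilbert_space \<Rightarrow> 'a) \<Rightarrow> ('a \<Rightarrow> 'a) \<Rightarrow> bool" where
  "op_le S T \<longleftrightarrow> (\<forall>x. 0 \<le> cinner x (T x - S x))"

text \<open>A map on the bounded operators is represented by a function on all functions; only its
  values on \<^const>\<open>bounded_ops\<close> matter.\<close>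

definition completely_positive ::
    "(('a::complex_hilbert_space \<Rightarrow> 'a) \<Rightarrow> ('a \<Rightarrow> 'a)) \<Rightarrow> bool" where
  "completely_positive \<Psi> \<longleftrightarrow>
     (\<forall>T\<in>bounded_ops. \<Psi> T \<in> bounded_ops) \<and>
     (\<forall>S\<in>bounded_ops. \<forall>T\<in>bounded_ops. \<Psi> (\<lambda>x. S x + T x) = (\<lambda>x. \<Psi> S x + \<Psi> T x)) \<and>
     (\<forall>c. \<forall>T\<in>bounded_ops. \<Psi> (\<lambda>x. c *\<^sub>C T x) = (\<lambda>x. c *\<^sub>C \<Psi> T x)) \<and>
     (\<forall>k T. (\<forall>i<k. \<forall>j<k. T i j \<in> bounded_ops) \<longrightarrow> positive_op_matrix k T \<longrightarrow>
        positive_op_matrix k (\<lambda>i j. \<Psi> (T i j)))"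

definition cp_maps :: "(('a::complex_hilbert_space \<Rightarrow> 'a) \<Rightarrow> ('a \<Rightarrow> 'a)) set" where
  "cp_maps = {\<Psi>. completely_positive \<Psi> \<and> op_le (\<Psi> id) id}"

text \<open>Nets are functions on a directed set \<open>(D, leq)\<close>; convergence along a net is convergence
  along the filter of its tails.\<close>

definition directed_set :: "'d set \<Rightarrow> ('d \<Rightarrow> 'd \<Rightarrow> bool) \<Rightarrow> bool" where
  "directed_set D leq \<longleftrightarrow> D \<noteq> {} \<and> (\<forall>a\<in>D. leq a a) \<and>
     (\<forall>a\<in>D. \<forall>b\<in>D. \<forall>c\<in>D. leq a b \<longrightarrow> leq b c \<longrightarrow> leq a c) \<and>
     (\<forall>a\<in>D. \<forall>b\<in>D. \<exists>c\<in>D. leq a c \<and> leq b c)"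

definition net_filter :: "'d set \<Rightarrow> ('d \<Rightarrow> 'd \<Rightarrow> bool) \<Rightarrow> 'd filter" where
  "net_filter D leq = (INF a\<in>D. principal {b \<in> D. leq a b})"

text \<open>\<open>h\<close> exhibits \<open>\<lambda>d. X (h d)\<close> as a subnet of a sequence \<open>X\<close>. This is the
  general (Moore--Smith) notion; \<open>h\<close> need not be monotone.\<close>

definition subnet_of_sequence :: "'d set \<Rightarrow> ('d \<Rightarrow> 'd \<Rightarrow> bool) \<Rightarrow> ('d \<Rightarrow> nat) \<Rightarrow> bool" where
  "subnet_of_sequence D leq h \<longleftrightarrow> directed_set D leq \<and>
     (\<forall>N. \<exists>a\<in>D. \<forall>b\<in>D. leq a b \<longrightarrow> N \<le> h b)"

definition wot_tendsto ::
    "('d \<Rightarrow> 'a::complex_hilbert_space \<Rightarrow> 'a) \<Rightarrow> ('a \<Rightarrow> 'a) \<Rightarrow> 'd filter \<Rightarrow> bool" where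
  "wot_tendsto T S F \<longleftrightarrow> (\<forall>x y. ((\<lambda>d. cinner x (T d y)) \<longlongrightarrow> cinner x (S y)) F)"

text \<open>The BW topology lives on \<^const>\<open>cp_maps\<close>, so the limit is required to be an element of
  it; convergence is pointwise on bounded operators in the weak operator topology.\<close>

definition bw_tendsto ::
    "('d \<Rightarrow> ('a::complex_hilbert_space \<Rightarrow> 'a) \<Rightarrow> ('a \<Rightarrow> 'a)) \<Rightarrow>
     (('a \<Rightarrow> 'a) \<Rightarrow> ('a \<Rightarrow> 'a)) \<Rightarrow> 'd filter \<Rightarrow> bool" where
  "bw_tendsto \<Psi> \<Phi> F \<longleftrightarrow>
     \<Phi> \<in> cp_maps \<and> (\<forall>T\<in>bounded_ops. wot_tendsto (\<lambda>d. \<Psi> d T) (\<Phi> T) F)"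


section \<open>Matrices\<close>

definition unitary_mat :: "nat \<Rightarrow> complex mat \<Rightarrow> bool" where
  "unitary_mat n U \<longleftrightarrow> U \<in> carrier_mat n n \<and>
     mat_adjoint U * U = 1\<^sub>m n \<and> U * mat_adjoint U = 1\<^sub>m n"

definition frobenius_norm :: "complex mat \<Rightarrow> real" where
  "frobenius_norm X = sqrt (\<Sum>i<dim_row X. \<Sum>j<dim_col X. (cmod (X $$ (i,j)))\<^sup>2)"

text \<open>For unitary \<open>U\<close>, the element of \<open>diagonalized_by U\<close> closest to \<open>X\<close> in Frobenius norm
  exists, is unique, and has the usual explicit form; see \<open>optimal_approx_explicit\<close> below.\<close>

definition diagonalized_by :: "complex mat \<Rightarrow> complex mat set" where
  "diagonalized_by U = {X \<in> carrier_mat (dim_row U) (dim_row U).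
     diagonal_mat (mat_adjoint U * X * U)}"

definition optimal_approx :: "complex mat \<Rightarrow> complex mat \<Rightarrow> complex mat" where
  "optimal_approx U X = (THE Y. Y \<in> diagonalized_by U \<and>
     (\<forall>Z\<in>diagonalized_by U. frobenius_norm (X - Y) \<le> frobenius_norm (X - Z)))"

definition diag_part :: "complex mat \<Rightarrow> complex mat" where
  "diag_part Y = mat (dim_row Y) (dim_col Y) (\<lambda>(i,j). if i = j then Y $$ (i,j) else 0)"

text \<open>Square roots of the eigenvalues of \<open>X\<^sup>* X\<close> (which are real and nonnegative), with
  multiplicity as roots of the characteristic polynomial.\<close>

definition singular_values :: "complex mat \<Rightarrow> real multiset" where
  "singular_values X =
     image_mset (\<lambda>z. sqrt (Re z)) (proots (char_poly (mat_adjoint X * X)))"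

definition uniform_cluster :: "(nat \<Rightarrow> complex mat) \<Rightarrow> (nat \<Rightarrow> complex mat) \<Rightarrow> bool" where
  "uniform_cluster X Y \<longleftrightarrow> (\<exists>N::nat. \<forall>\<epsilon>>0. \<exists>N2::nat. \<forall>n>N2.
     size (filter_mset (\<lambda>s. s \<notin> {0..<\<epsilon>}) (singular_values (X n - Y n))) \<le> N)"


subsection \<open>Well-definedness of the optimal approximation, and its explicit form\<close>

lemma mat_adjoint_carrier [simp]:
  "A \<in> carrier_mat m n \<Longrightarrow> mat_adjoint A \<in> carrier_mat n m"
  by (auto simp: mat_adjoint_def)

lemma mat_adjoint_dim [simp]:
  "dim_row (mat_adjoint A) = dim_col A" "dim_col (mat_adjoint A) = dim_row A"
  by (auto simp: mat_adjoint_def)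

lemma mat_adjoint_index:
  "i < dim_col A \<Longrightarrow> j < dim_row A \<Longrightarrow>
    mat_adjoint A $$ (i,j) = cnj ((A::complex mat) $$ (j,i))"
  by (simp add: mat_adjoint_def mat_of_rows_index)

lemma mat_adjoint_mult:
  assumes "A \<in> carrier_mat m n" "B \<in> carrier_mat n k"
  shows "mat_adjoint (A * B) = mat_adjoint B * mat_adjoint (A::complex mat)"
  using assms by (intro eq_matI) (auto simp: mat_adjoint_index scalar_prod_def mult.commute)

lemma mat_adjoint_adjoint: "mat_adjoint (mat_adjoint A) = (A::complex mat)"
  by (intro eq_matI) (auto simp: mat_adjoint_index)

definition frob2 :: "complex mat \<Rightarrow> real" where
  "frob2 X = (\<Sum>i<dim_row X. \<Sum>j<dim_col X. (cmod (X $$ (i,j)))\<^sup>2)"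

lemma frob2_adjoint: "frob2 (mat_adjoint X) = frob2 X"
  unfolding frob2_def by (subst sum.swap) (simp add: mat_adjoint_index)

lemma frob2_trace:
  "complex_of_real (frob2 X) = (\<Sum>j<dim_col X. (mat_adjoint X * X) $$ (j,j))"
proof -
  have "(mat_adjoint X * X) $$ (j,j) = (\<Sum>i<dim_row X. complex_of_real ((cmod (X $$ (i,j)))\<^sup>2))"
    if "j < dim_col X" for j
    using that unfolding complex_norm_square
    by (simp add: scalar_prod_def mat_adjoint_index atLeast0LessThan mult.commute)
  then show ?thesis
    unfolding frob2_def by (subst sum.swap) simp
qed

lemma frob2_unitary_left:
  assumes U: "unitary_mat n U" and X: "X \<in> carrier_mat n n"
  shows "frob2 (U * X) = frob2 X"
proof -
  have Uc: "U \<in> carrier_mat n n" and UU: "mat_adjoint U * U = 1\<^sub>m n"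
    using U by (auto simp: unitary_mat_def)
  note A = mat_adjoint_carrier[OF Uc] mat_adjoint_carrier[OF X]
  have "mat_adjoint (U * X) * (U * X) = mat_adjoint X * (mat_adjoint U * (U * X))"
    using Uc X A by (simp add: mat_adjoint_mult[OF Uc X] assoc_mult_mat[of _ n n _ n _ n])
  also have "mat_adjoint U * (U * X) = X"
    using Uc X A UU by (simp flip: assoc_mult_mat[of _ n n _ n _ n])
  finally have "complex_of_real (frob2 (U * X)) = complex_of_real (frob2 X)"
    unfolding frob2_trace using Uc X by simp
  then show ?thesis by simp
qed

lemma unitary_mat_adjoint: "unitary_mat n U \<Longrightarrow> unitary_mat n (mat_adjoint U)"
  by (auto simp: unitary_mat_def mat_adjoint_adjoint)

lemma frob2_unitary_right:
  assumes U: "unitary_mat n U" and X: "X \<in> carrier_mat n n"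
  shows "frob2 (X * U) = frob2 X"
proof -
  have Uc: "U \<in> carrier_mat n n" using U by (auto simp: unitary_mat_def)
  have "frob2 (X * U) = frob2 (mat_adjoint U * mat_adjoint X)"
    by (metis frob2_adjoint mat_adjoint_mult[OF X Uc])
  also have "\<dots> = frob2 (mat_adjoint X)"
    by (rule frob2_unitary_left[OF unitary_mat_adjoint[OF U] mat_adjoint_carrier[OF X]])
  finally show ?thesis by (simp add: frob2_adjoint)
qed

lemma frob2_conj:
  assumes U: "unitary_mat n U" and X: "X \<in> carrier_mat n n" and Y: "Y \<in> carrier_mat n n"
  shows "frob2 (X - Y) = frob2 (mat_adjoint U * X * U - mat_adjoint U * Y * U)"
proof -
  have Uc: "U \<in> carrier_mat n n" using U by (auto simp: unitary_mat_def)
  note A = mat_adjoint_carrier[OF Uc]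
  have XY: "X - Y \<in> carrier_mat n n" using X Y by auto
  have "mat_adjoint U * X * U - mat_adjoint U * Y * U = mat_adjoint U * (X - Y) * U"
    using X Y Uc A XY
    by (simp add: mult_minus_distrib_mat[of _ n n _ n] minus_mult_distrib_mat[of _ n n _ _ n]
        mult_carrier_mat[of _ n n _ n])
  moreover have "frob2 (mat_adjoint U * (X - Y) * U) = frob2 (mat_adjoint U * (X - Y))"
    by (rule frob2_unitary_right[OF U]) (use A XY in auto)
  moreover have "\<dots> = frob2 (X - Y)"
    by (rule frob2_unitary_left[OF unitary_mat_adjoint[OF U] XY])
  ultimately show ?thesis by simp
qed

lemma frob2_diff_diagonal:
  assumes X: "X \<in> carrier_mat n n" and D: "D \<in> carrier_mat n n" "diagonal_mat D"
  shows "frob2 (X - D) = frob2 (X - diag_part X) + frob2 (diag_part X - D)"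
proof -
  have eq: "(cmod ((X - D) $$ (i,j)))\<^sup>2 =
      (cmod ((X - diag_part X) $$ (i,j)))\<^sup>2 + (cmod ((diag_part X - D) $$ (i,j)))\<^sup>2"
    if "i < n" "j < n" for i j
    using that X D by (auto simp: diag_part_def diagonal_mat_def)
  show ?thesis
    unfolding frob2_def sum.distrib[symmetric]
    using X D eq by (auto intro!: sum.cong simp: diag_part_def)
qed

lemma frob2_nonneg: "frob2 X \<ge> 0"
  unfolding frob2_def by (intro sum_nonneg) auto

lemma frob2_diff_eq_0:
  assumes "X \<in> carrier_mat n n" "Y \<in> carrier_mat n n" "frob2 (X - Y) = 0"
  shows "X = Y"
proof (rule eq_matI)
  fix i j assume ij: "i < dim_row Y" "j < dim_col Y"
  have "\<forall>i<n. \<forall>j<n. (cmod ((X - Y) $$ (i,j)))\<^sup>2 = 0"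
    using assms unfolding frob2_def
    by (auto simp: sum_nonneg_eq_0_iff sum_nonneg)
  then show "X $$ (i,j) = Y $$ (i,j)" using ij assms by auto
qed (use assms in auto)

lemma optimal_approx_explicit:
  assumes U: "unitary_mat n U" and X: "X \<in> carrier_mat n n"
  defines "Y \<equiv> U * diag_part (mat_adjoint U * X * U) * mat_adjoint U"
  shows "Y \<in> diagonalized_by U"
    and "\<And>Z. Z \<in> diagonalized_by U \<Longrightarrow> frobenius_norm (X - Y) \<le> frobenius_norm (X - Z)"
    and "optimal_approx U X = Y"
proof -
  have Uc: "U \<in> carrier_mat n n" and UU: "mat_adjoint U * U = 1\<^sub>m n" "U * mat_adjoint U = 1\<^sub>m n"
    using U by (auto simp: unitary_mat_def)
  note A = mat_adjoint_carrier[OF Uc]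
  define C where "C Z = mat_adjoint U * Z * U" for Z
  have Cc: "C Z \<in> carrier_mat n n" if "Z \<in> carrier_mat n n" for Z
    using that Uc A by (auto simp: C_def)
  have dc: "diag_part Z \<in> carrier_mat n n" if "Z \<in> carrier_mat n n" for Z
    using that by (auto simp: diag_part_def)
  have CU: "C (U * Z * mat_adjoint U) = Z" if Z: "Z \<in> carrier_mat n n" for Z
  proof -
    have "C (U * Z * mat_adjoint U) = (mat_adjoint U * U) * Z * (mat_adjoint U * U)"
      using Z Uc A unfolding C_def by (simp add: assoc_mult_mat[of _ n n _ n _ n] mult_carrier_mat[of _ n n _ n])
    then show ?thesis using Z UU by simp
  qed
  have UC: "U * C Z * mat_adjoint U = Z" if Z: "Z \<in> carrier_mat n n" for Z
  proof -
    have "U * C Z * mat_adjoint U = (U * mat_adjoint U) * Z * (U * mat_adjoint U)"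
      using Z Uc A unfolding C_def by (simp add: assoc_mult_mat[of _ n n _ n _ n] mult_carrier_mat[of _ n n _ n])
    then show ?thesis using Z UU by simp
  qed
  have Y: "Y = U * diag_part (C X) * mat_adjoint U" unfolding Y_def C_def ..
  have Yc: "Y \<in> carrier_mat n n" using Uc A dc[OF Cc[OF X]] unfolding Y by auto
  have CY: "C Y = diag_part (C X)" unfolding Y by (rule CU[OF dc[OF Cc[OF X]]])
  have M: "Z \<in> diagonalized_by U \<longleftrightarrow> Z \<in> carrier_mat n n \<and> diagonal_mat (C Z)" for Z
    using Uc by (auto simp: diagonalized_by_def C_def)
  show YM: "Y \<in> diagonalized_by U"
    unfolding M CY using Yc by (auto simp: diag_part_def diagonal_mat_def)
  have key: "frob2 (X - Z) = frob2 (X - Y) + frob2 (Y - Z)"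
    if "Z \<in> diagonalized_by U" for Z
  proof -
    have Z: "Z \<in> carrier_mat n n" "diagonal_mat (C Z)" using that M by auto
    have "frob2 (X - Z) = frob2 (C X - C Z)"
      unfolding C_def by (rule frob2_conj[OF U X Z(1)])
    also have "\<dots> = frob2 (C X - diag_part (C X)) + frob2 (diag_part (C X) - C Z)"
      by (rule frob2_diff_diagonal[OF Cc[OF X] Cc[OF Z(1)] Z(2)])
    also have "frob2 (C X - diag_part (C X)) = frob2 (X - Y)"
      using frob2_conj[OF U X Yc] by (simp only: C_def[symmetric] CY)
    also have "frob2 (diag_part (C X) - C Z) = frob2 (Y - Z)"
      using frob2_conj[OF U Yc Z(1)] by (simp only: C_def[symmetric] CY)
    finally show ?thesis .
  qed
  have fn: "frobenius_norm Z = sqrt (frob2 Z)" for Z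
    by (simp add: frobenius_norm_def frob2_def)
  show le: "frobenius_norm (X - Y) \<le> frobenius_norm (X - Z)" if "Z \<in> diagonalized_by U" for Z
    unfolding fn key[OF that] using frob2_nonneg by simp
  show "optimal_approx U X = Y"
    unfolding optimal_approx_def
  proof (rule the_equality)
    fix Z assume Z: "Z \<in> diagonalized_by U \<and>
      (\<forall>Z'\<in>diagonalized_by U. frobenius_norm (X - Z) \<le> frobenius_norm (X - Z'))"
    then have "frobenius_norm (X - Z) \<le> frobenius_norm (X - Y)" using YM by blast
    then have "frob2 (Y - Z) = 0"
      using key[of Z] Z frob2_nonneg[of "Y - Z"] by (simp add: fn)
    then show "Z = Y" using frob2_diff_eq_0[OF Yc, of Z] Z M by auto
  qed (use YM le in blast)
qed


section \<open>Operators as matrices\<close>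

text \<open>The family \<open>e 0, \<dots>, e (n - 1)\<close> is an orthonormal basis of the subspace \<open>S\<close>; the values
  \<open>e i\<close> for \<open>i \<ge> n\<close> are irrelevant.\<close>

definition onb_of :: "nat \<Rightarrow> (nat \<Rightarrow> 'a::complex_hilbert_space) \<Rightarrow> 'a set \<Rightarrow> bool" where
  "onb_of n e S \<longleftrightarrow>
     (\<forall>i<n. \<forall>j<n. cinner (e i) (e j) = (if i = j then 1 else 0)) \<and> cvs.span (e ` {..<n}) = S"

definition mat_of_op ::
    "nat \<Rightarrow> (nat \<Rightarrow> 'a::complex_hilbert_space) \<Rightarrow> ('a \<Rightarrow> 'a) \<Rightarrow> complex mat" where
  "mat_of_op n e T = mat n n (\<lambda>(i,j). cinner (e i) (T (e j)))"

definition op_of_mat ::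
    "nat \<Rightarrow> (nat \<Rightarrow> 'a::complex_hilbert_space) \<Rightarrow> complex mat \<Rightarrow> ('a \<Rightarrow> 'a)" where
  "op_of_mat n e X = (\<lambda>x. \<Sum>i<n. \<Sum>j<n. (X $$ (i,j) * cinner (e j) x) *\<^sub>C e i)"

definition section_mat ::
    "('a::complex_hilbert_space \<Rightarrow> 'a) \<Rightarrow> nat \<Rightarrow> (nat \<Rightarrow> 'a) \<Rightarrow> ('a \<Rightarrow> 'a) \<Rightarrow> complex mat" where
  "section_mat P n e A = mat_of_op n e (P \<circ> A \<circ> P)"

definition approx_map ::
    "(nat \<Rightarrow> 'a::complex_hilbert_space \<Rightarrow> 'a) \<Rightarrow> (nat \<Rightarrow> nat \<Rightarrow> 'a) \<Rightarrow> (nat \<Rightarrow> complex mat) \<Rightarrow>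
     nat \<Rightarrow> ('a \<Rightarrow> 'a) \<Rightarrow> ('a \<Rightarrow> 'a)" where
  "approx_map P e U n A =
     op_of_mat n (e n) (optimal_approx (U n) (section_mat (P n) n (e n) A))"

end

theory Submission
  imports Defs
begin

text \<open>Write \<open>X n\<close> for the optimal approximation of the matrix \<open>Y n\<close> of the compression
  \<open>P n A P n\<close>. Uniform cluster provides one bound \<open>N\<close> such that, for every \<open>\<epsilon>\<close>, all but at most
  \<open>N\<close> singular values of \<open>X n - Y n\<close> are eventually below \<open>\<epsilon>\<close>. Since compressions converge
  strongly to \<open>A\<close>, the operators given by \<open>X n - Y n\<close> converge weakly, along the subnet, to
  \<open>B = \<Phi> A - A\<close>. The point is that the condition of
  being, up to \<open>\<epsilon>\<close>, of rank at most \<open>N\<close> passes to weak limits.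

  Suppose that \<open>B\<close> has infinite rank. Gram--Schmidt in the range of \<open>B\<close> gives vectors
  \<open>y 0, \<dots>, y N\<close> whose images \<open>B (y s)\<close> are orthonormal
  (\<open>finite_rank_or_orthonormal_images\<close>). For each \<open>n\<close> far along, the at most \<open>N\<close> linear
  conditions of orthogonality to the singular vectors with singular value \<open>\<ge> \<epsilon>\<close> have a solution
  \<open>w = (\<Sum>s\<le>N. c s *\<^sub>C y s)\<close> with \<open>c\<close> a unit vector, and the operator of \<open>X n - Y n\<close> maps \<open>w\<close>
  to a vector of norm at most \<open>\<epsilon> * norm w\<close> (\<open>op_of_mat_small_combination\<close>). On the other hand
  \<open>B w\<close> is a unit vector, and the inner product of \<open>B w\<close> with the image of \<open>w\<close> is close to
  \<open>cinner (B w) (B w) = 1\<close>. This closeness is uniform in \<open>c\<close> because the inner product depends on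
  the operator only through the finitely many numbers \<open>cinner (B (y s)) (R (y t))\<close>, which converge.
  So the unknown dependence of \<open>c\<close> on \<open>n\<close> does no harm, and there is a contradiction
  (\<open>orthonormal_images_of_weak_limit\<close>).

  The matrix part rests on the spectral theorem for Hermitian matrices, in a form that lists the
  eigenvalues with their multiplicities as roots of the characteristic polynomial
  (\<open>hermitian_unitarily_diagonalizable\<close>), since singular values are counted that way.\<close>

section \<open>The spectral theorem for Hermitian matrices\<close>

no_notation vec_nth (infixl "$" 90)

lemma adjoint_cscalar_prod:
  fixes A :: "complex mat"
  assumes "A \<in> carrier_mat m n" "x \<in> carrier_vec n" "y \<in> carrier_vec m"
  shows "(A *\<^sub>v x) \<bullet>c y = x \<bullet>c (mat_adjoint A *\<^sub>v y)"
proof -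
  have "(A *\<^sub>v x) \<bullet>c y = (\<Sum>i<m. \<Sum>j<n. A $$ (i,j) * x $ j * cnj (y $ i))"
    using assms by (simp add: scalar_prod_def atLeast0LessThan sum_distrib_right)
  also have "\<dots> = (\<Sum>j<n. \<Sum>i<m. A $$ (i,j) * x $ j * cnj (y $ i))"
    by (rule sum.swap)
  also have "\<dots> = x \<bullet>c (mat_adjoint A *\<^sub>v y)"
    using assms
    by (simp add: scalar_prod_def atLeast0LessThan sum_distrib_left mat_adjoint_index
        cnj_sum mult_ac)
  finally show ?thesis .
qed

definition sqnorm_vec :: "complex vec \<Rightarrow> real" where
  "sqnorm_vec v = (\<Sum>i<dim_vec v. (cmod (v $ i))\<^sup>2)"

lemma sqnorm_vec_cscalar_prod: "complex_of_real (sqnorm_vec v) = v \<bullet>c v"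
  by (simp add: sqnorm_vec_def scalar_prod_def atLeast0LessThan complex_norm_square
      del: of_real_power)

lemma sqnorm_vec_eq_0:
  assumes "v \<in> carrier_vec n"
  shows "sqnorm_vec v = 0 \<longleftrightarrow> v = 0\<^sub>v n"
  using conjugate_square_eq_0_vec[OF assms] sqnorm_vec_cscalar_prod[of v]
  by (metis of_real_eq_0_iff)

lemma sqnorm_vec_nonneg: "sqnorm_vec v \<ge> 0"
  by (simp add: sqnorm_vec_def sum_nonneg)

text \<open>Gram--Schmidt turns a basis that starts with \<open>v\<close> into an orthogonal one whose first vector is
  still \<open>v\<close>. It does not normalise, so the columns are rescaled afterwards.\<close>

lemma unitary_first_column:
  assumes v: "v \<in> carrier_vec n" "v \<noteq> 0\<^sub>v n"
  shows "\<exists>W c. unitary_mat n W \<and> col W 0 = c \<cdot>\<^sub>v v"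
proof -
  interpret cof_vec_space n "TYPE(complex)" .
  define b where "b = basis_completion v"
  define ws where "ws = gram_schmidt n b"
  note bc = basis_completion[OF v, folded b_def]
  have n: "n > 0" using v by (intro gr0I) auto
  from bc(6,7) n obtain vs where b: "b = v # vs" by (cases b) auto
  have ws: "set ws \<subseteq> carrier_vec n" "corthogonal ws" "length ws = n"
    using gram_schmidt_result[OF bc(2,4,5) ws_def] bc(6) by auto
  have hd: "ws ! 0 = v"
    using gram_schmidt_hd[OF v(1), of vs, folded b ws_def] ws(3) n
    by (simp add: hd_conv_nth flip: length_greater_0_conv)
  have wc: "ws ! i \<in> carrier_vec n" if "i < n" for i using ws that by auto
  define d where "d i = complex_of_real (1 / sqrt (sqnorm_vec (ws ! i)))" for i
  define W where "W = mat n n (\<lambda>(i,j). d j * ws ! j $ i)"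
  have W: "W \<in> carrier_mat n n" by (simp add: W_def)
  have "(mat_adjoint W * W) $$ (i,j) = (1\<^sub>m n :: complex mat) $$ (i,j)" if ij: "i < n" "j < n" for i j
  proof -
    have "(mat_adjoint W * W) $$ (i,j) = d i * d j * (ws ! j \<bullet>c ws ! i)"
      using ij W wc[OF ij(1)] wc[OF ij(2)]
      by (simp add: scalar_prod_def mat_adjoint_index W_def d_def sum_distrib_left mult_ac)
    also have "\<dots> = (if i = j then 1 else 0)"
    proof (cases "i = j")
      case True
      have "ws ! i \<bullet>c ws ! i \<noteq> 0" using corthogonalD[OF ws(2), of i i] ij ws(3) by auto
      then have "sqnorm_vec (ws ! i) \<noteq> 0" using sqnorm_vec_cscalar_prod by (metis of_real_0)
      then have pos: "sqnorm_vec (ws ! i) > 0" using sqnorm_vec_nonneg[of "ws ! i"] by linarith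
      have "d i * d i * (ws ! i \<bullet>c ws ! i) =
          complex_of_real (1 / sqrt (sqnorm_vec (ws ! i)) * (1 / sqrt (sqnorm_vec (ws ! i)))
            * sqnorm_vec (ws ! i))"
        unfolding d_def by (simp only: of_real_mult sqnorm_vec_cscalar_prod)
      also have "\<dots> = 1" using pos by simp
      finally show ?thesis using True by simp
    qed (use corthogonalD[OF ws(2), of j i] ij ws(3) in auto)
    finally show ?thesis using ij by simp
  qed
  then have WW: "mat_adjoint W * W = 1\<^sub>m n"
    using W by (intro eq_matI) auto
  then have "unitary_mat n W"
    using mat_mult_left_right_inverse[OF mat_adjoint_carrier[OF W] W] W
    by (simp add: unitary_mat_def)
  moreover have "col W 0 = d 0 \<cdot>\<^sub>v v"
    using n hd v by (intro eq_vecI) (auto simp: W_def)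
  ultimately show ?thesis by blast
qed

text \<open>Deflation. A unitary \<open>W\<close> whose first column is an eigenvector for \<open>e\<close> conjugates \<open>A\<close> to a
  Hermitian matrix with first column \<open>(e, 0, \<dots>, 0)\<close>. By Hermitian symmetry the first row has
  the same form, so the conjugate is block diagonal, and the lower block is again Hermitian with the
  remaining eigenvalues. The equation is stated without inverses, as \<open>A * V = V * D\<close>.\<close>

lemma hermitian_unitarily_diagonalizable:
  fixes A :: "complex mat"
  assumes "A \<in> carrier_mat n n" "mat_adjoint A = A"
    and "char_poly A = (\<Prod>e\<leftarrow>es. [:- e, 1:])"
  shows "\<exists>V. unitary_mat n V \<and> A * V = V * mat_diag n (\<lambda>i. es ! i)"
  using assms
proof (induction es arbitrary: n A)
  case Nil
  then have "n = 0" using degree_monic_char_poly[OF Nil(1)] by simp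
  then have "unitary_mat n (1\<^sub>m n)" "A * 1\<^sub>m n = 1\<^sub>m n * mat_diag n (\<lambda>i. [] ! i)"
    using Nil(1) by (auto simp: unitary_mat_def mat_diag_def)
  then show ?case by blast
next
  case (Cons e es)
  have "eigenvalue A e"
    unfolding eigenvalue_root_char_poly[OF Cons.prems(1)] Cons.prems(3) by simp
  then obtain v where v: "v \<in> carrier_vec n" "v \<noteq> 0\<^sub>v n" "A *\<^sub>v v = e \<cdot>\<^sub>v v"
    using Cons.prems(1) unfolding eigenvalue_def eigenvector_def by auto
  then obtain m where n: "n = Suc m" by (cases n) auto
  obtain W c where W: "unitary_mat n W" and col: "col W 0 = c \<cdot>\<^sub>v v"
    using unitary_first_column[OF v(1,2)] by blast
  have Wc: "W \<in> carrier_mat n n" and WW: "mat_adjoint W * W = 1\<^sub>m n" "W * mat_adjoint W = 1\<^sub>m n"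
    using W by (auto simp: unitary_mat_def)
  note Wa = mat_adjoint_carrier[OF Wc]
  note Ac = Cons.prems(1)
  define A' where "A' = mat_adjoint W * (A * W)"
  have A'c: "A' \<in> carrier_mat n n" unfolding A'_def by (intro mult_carrier_mat[of _ n n _ n] Wa Ac Wc)
  have AW: "A * W = W * A'"
    using Wa Ac Wc WW by (simp add: A'_def mult_carrier_mat[of _ n n _ n] flip: assoc_mult_mat[of W n n _ n _ n])
  have herm': "mat_adjoint A' = A'"
    using Wa Ac Wc Cons.prems(2)
    by (simp add: A'_def mat_adjoint_mult[of _ n n _ n] mat_adjoint_adjoint
        assoc_mult_mat[of _ n n _ n _ n] mult_carrier_mat[of _ n n _ n])
  have "col A' 0 = mat_adjoint W *\<^sub>v (A *\<^sub>v col W 0)"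
    using n col_mult2[OF Wa mult_carrier_mat[OF Ac Wc], of 0] col_mult2[OF Ac Wc, of 0]
    by (simp only: A'_def zero_less_Suc simp_thms)
  also have "\<dots> = e \<cdot>\<^sub>v (mat_adjoint W *\<^sub>v col W 0)"
    using v Wa Ac by (simp add: col mult_mat_vec[of _ n n] smult_smult_assoc mult.commute)
  also have "mat_adjoint W *\<^sub>v col W 0 = unit_vec n 0"
    using col_mult2[OF Wa Wc, of 0] n WW by simp
  finally have col0: "col A' 0 = e \<cdot>\<^sub>v unit_vec n 0" .
  have c0: "A' $$ (i,0) = (if i = 0 then e else 0)" if "i < n" for i
    using arg_cong[OF col0, of "\<lambda>u. u $ i"] that n A'c by (auto simp: unit_vec_def split: if_splits)
  have r0: "A' $$ (0,j) = 0" if "0 < j" "j < n" for j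
    using arg_cong[OF herm', of "\<lambda>X. X $$ (0,j)"] c0[of j] that n A'c
    by (auto simp: mat_adjoint_index)
  define B where "B = mat m m (\<lambda>(i,j). A' $$ (Suc i, Suc j))"
  have Bc: "B \<in> carrier_mat m m" by (simp add: B_def)
  define E where "E = mat 1 1 (\<lambda>_. e)"
  have Ec: "E \<in> carrier_mat 1 1" by (simp add: E_def)
  have A'blk: "A' = four_block_mat E (0\<^sub>m 1 m) (0\<^sub>m m 1) B"
  proof (rule eq_matI)
    fix i j assume "i < dim_row (four_block_mat E (0\<^sub>m 1 m) (0\<^sub>m m 1) B)"
      "j < dim_col (four_block_mat E (0\<^sub>m 1 m) (0\<^sub>m m 1) B)"
    then have ij: "i < n" "j < n" by (auto simp: E_def B_def n)
    show "A' $$ (i,j) = four_block_mat E (0\<^sub>m 1 m) (0\<^sub>m m 1) B $$ (i,j)"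
      using ij c0 r0 by (cases i; cases j) (auto simp: E_def B_def n)
  qed (use A'c in \<open>auto simp: E_def B_def n\<close>)
  have Bherm: "mat_adjoint B = B"
  proof (rule eq_matI)
    fix i j assume "i < dim_row B" "j < dim_col B"
    then show "mat_adjoint B $$ (i,j) = B $$ (i,j)"
      using arg_cong[OF herm', of "\<lambda>X. X $$ (Suc i, Suc j)"] A'c n
      by (auto simp: mat_adjoint_index B_def)
  qed (auto simp: B_def)
  have "similar_mat A A'"
    unfolding similar_mat_def
  proof (intro exI, rule similar_mat_witI[of W "mat_adjoint W" n])
    show "A = W * A' * mat_adjoint W"
      using Ac Wc Wa WW unfolding AW[symmetric] by (simp add: assoc_mult_mat[of _ n n _ n _ n] mult_carrier_mat[of _ n n _ n])
  qed (use WW Ac A'c Wc Wa in auto)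
  then have "char_poly A = char_poly E * char_poly B"
    using char_poly_similar[of A A'] char_poly_four_block_zeros_col[OF Ec zero_carrier_mat Bc]
    unfolding A'blk by metis
  moreover have "char_poly E = [:- e, 1:]"
    by (simp add: E_def char_poly_defs det_def sign_def)
  ultimately have "[:- e, 1:] * char_poly B = [:- e, 1:] * (\<Prod>e\<leftarrow>es. [:- e, 1:])"
    using Cons.prems(3) by (simp only: list.map prod_list.Cons)
  then have "char_poly B = (\<Prod>e\<leftarrow>es. [:- e, 1:])"
    by (subst (asm) mult_left_cancel) simp
  from Cons.IH[OF Bc Bherm this] obtain V where V: "unitary_mat m V"
    and BV: "B * V = V * mat_diag m (\<lambda>i. es ! i)" by blast
  have Vc: "V \<in> carrier_mat m m" and VV: "mat_adjoint V * V = 1\<^sub>m m"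
    using V by (auto simp: unitary_mat_def)
  define K where "K = four_block_mat (1\<^sub>m 1) (0\<^sub>m 1 m) (0\<^sub>m m 1) V"
  have Kc: "K \<in> carrier_mat n n" using Vc by (auto simp: K_def n)
  have Ka: "mat_adjoint K = four_block_mat (1\<^sub>m 1) (0\<^sub>m 1 m) (0\<^sub>m m 1) (mat_adjoint V)"
    using Vc by (intro eq_matI) (auto simp: K_def mat_adjoint_index)
  have id_blk: "four_block_mat (1\<^sub>m 1) (0\<^sub>m 1 m) (0\<^sub>m m 1) (1\<^sub>m m) = (1\<^sub>m n :: complex mat)"
    by (intro eq_matI) (auto simp: n)
  have KK: "mat_adjoint K * K = 1\<^sub>m n"
    unfolding Ka id_blk[symmetric] unfolding K_def using VV Vc mat_adjoint_carrier[OF Vc]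
    by (subst mult_four_block_mat[of _ 1 1 _ m _ m _ _ 1 _ m]) auto
  define D where "D = mat_diag n (\<lambda>i. (e # es) ! i)"
  have Dc: "D \<in> carrier_mat n n" by (simp add: D_def)
  have D: "D = four_block_mat E (0\<^sub>m 1 m) (0\<^sub>m m 1) (mat_diag m (\<lambda>i. es ! i))"
    by (intro eq_matI) (auto simp: n D_def E_def mat_diag_def nth_Cons' split: if_splits)
  have "A' * K = four_block_mat E (0\<^sub>m 1 m) (0\<^sub>m m 1) (B * V)"
    unfolding A'blk K_def using Bc Vc Ec
    by (subst mult_four_block_mat[of _ 1 1 _ m _ m _ _ 1 _ m]) auto
  also have "\<dots> = K * D"
    unfolding K_def D BV using Vc Ec
    by (subst mult_four_block_mat[of _ 1 1 _ m _ m _ _ 1 _ m])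
      (auto simp: left_mult_zero_mat[OF mat_diag_dim])
  finally have A'K: "A' * K = K * D" .
  have "A * (W * K) = W * A' * K"
    unfolding AW[symmetric] by (rule assoc_mult_mat[OF Ac Wc Kc, symmetric])
  also have "\<dots> = W * (K * D)"
    unfolding A'K[symmetric] by (rule assoc_mult_mat[OF Wc A'c Kc])
  also have "\<dots> = W * K * D"
    by (rule assoc_mult_mat[OF Wc Kc Dc, symmetric])
  finally have "A * (W * K) = W * K * D" .
  moreover have "mat_adjoint (W * K) * (W * K) = mat_adjoint K * (mat_adjoint W * (W * K))"
    unfolding mat_adjoint_mult[OF Wc Kc]
    by (rule assoc_mult_mat[OF mat_adjoint_carrier[OF Kc] Wa mult_carrier_mat[OF Wc Kc]])
  then have *: "mat_adjoint (W * K) * (W * K) = 1\<^sub>m n"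
    using assoc_mult_mat[OF Wa Wc Kc] WW KK Kc by simp
  moreover have WKc: "W * K \<in> carrier_mat n n" by (rule mult_carrier_mat[OF Wc Kc])
  moreover have "(W * K) * mat_adjoint (W * K) = 1\<^sub>m n"
    by (rule mat_mult_left_right_inverse[OF mat_adjoint_carrier[OF WKc] WKc *])
  ultimately show ?case unfolding D_def unitary_mat_def by blast
qed

section \<open>Few large singular values\<close>

lemma proots_prod_linear_factors:
  fixes es :: "'a :: idom list"
  shows "proots (\<Prod>a\<leftarrow>es. [:- a, 1:]) = mset es"
proof (induction es)
  case (Cons e es)
  have "(\<Prod>a\<leftarrow>es. [:- a, 1:]) \<noteq> 0"
    by (auto simp: prod_list_zero_iff)
  then show ?case using Cons by (simp add: proots_mult del: mult_pCons_left)
qed simp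

text \<open>In an orthonormal eigenbasis of \<open>Z\<^sup>* Z\<close>, the quadratic form of \<open>Z\<^sup>* Z\<close> is the sum of the
  eigenvalues weighted by the squared coordinates, so it is at most \<open>\<epsilon>\<^sup>2\<close> times the squared norm on
  vectors without coordinates at large eigenvalues. In the span of \<open>k\<close> columns such a vector
  exists because it has to satisfy fewer than \<open>k\<close> linear equations. The coefficient vector \<open>c\<close>
  is nonzero even if the columns of \<open>M\<close> are linearly dependent.\<close>

lemma exists_small_combination:
  fixes Z M :: "complex mat"
  assumes Z: "Z \<in> carrier_mat n n" and M: "M \<in> carrier_mat n k"
    and few: "size (filter_mset (\<lambda>s. s \<notin> {0..<\<epsilon>}) (singular_values Z)) < k"
  shows "\<exists>c \<in> carrier_vec k. c \<noteq> 0\<^sub>v k \<and>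
    sqnorm_vec (Z *\<^sub>v (M *\<^sub>v c)) \<le> \<epsilon>\<^sup>2 * sqnorm_vec (M *\<^sub>v c)"
proof -
  define H where "H = mat_adjoint Z * Z"
  note Za = mat_adjoint_carrier[OF Z]
  have Hc: "H \<in> carrier_mat n n" unfolding H_def by (rule mult_carrier_mat[OF Za Z])
  have "mat_adjoint H = H"
    unfolding H_def mat_adjoint_mult[OF Za Z] mat_adjoint_adjoint ..
  moreover obtain es where es: "char_poly H = (\<Prod>a\<leftarrow>es. [:- a, 1:])" "length es = n"
    using char_poly_factorized[OF Hc] by blast
  ultimately obtain V where V: "unitary_mat n V" and HV: "H * V = V * mat_diag n (\<lambda>i. es ! i)"
    using hermitian_unitarily_diagonalizable[OF Hc] by blast
  have Vc: "V \<in> carrier_mat n n" and VV: "mat_adjoint V * V = 1\<^sub>m n" "V * mat_adjoint V = 1\<^sub>m n"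
    using V by (auto simp: unitary_mat_def)
  note Va = mat_adjoint_carrier[OF Vc]
  define bad where "bad z \<longleftrightarrow> sqrt (Re z) \<notin> {0..<\<epsilon>}" for z :: complex
  have "proots (char_poly H) = mset es"
    unfolding es(1) by (rule proots_prod_linear_factors)
  then have sz: "size (filter_mset (\<lambda>s. s \<notin> {0..<\<epsilon>}) (singular_values Z)) = length (filter bad es)"
    unfolding singular_values_def H_def[symmetric] bad_def
    by (simp add: filter_mset_image_mset o_def flip: mset_filter)
  define J where "J = filter (\<lambda>j. bad (es ! j)) [0..<n]"
  have "map ((!) es) [0..<n] = es" using map_nth[of es] es(2) by simp
  then have "length (filter bad es) = length J"
    unfolding J_def by (metis (no_types, lifting) filter_map length_map comp_apply filter_cong)
  with few sz have Jk: "length J < k" by simp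
  \<comment> \<open>The equations for \<open>c\<close>, filled up with zero rows to a square matrix. There is at least one
    zero row, so the determinant vanishes and there is a nonzero solution.\<close>
  define Q where "Q = mat k k (\<lambda>(r,s). if r < length J then (mat_adjoint V * M) $$ (J ! r, s) else 0)"
  have Qc: "Q \<in> carrier_mat k k" by (simp add: Q_def)
  have "Q = mat\<^sub>r k k (\<lambda>i. if i = length J then 0\<^sub>v k else row Q i)"
    using Jk by (intro eq_matI) (auto simp: Q_def)
  moreover have "det (mat\<^sub>r k k (\<lambda>i. if i = length J then 0\<^sub>v k else row Q i)) = 0"
    by (rule det_row_0[OF Jk]) (use Qc in auto)
  ultimately have "det Q = 0" by simp
  then obtain c where c: "c \<in> carrier_vec k" "c \<noteq> 0\<^sub>v k" "Q *\<^sub>v c = 0\<^sub>v k"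
    using det_0_iff_vec_prod_zero_field[OF Qc] by blast
  define x where "x = M *\<^sub>v c"
  define y where "y = mat_adjoint V *\<^sub>v x"
  have xc: "x \<in> carrier_vec n" using M c by (simp add: x_def)
  have yc: "y \<in> carrier_vec n" using mult_mat_vec_carrier[OF Va xc] by (simp add: y_def)
  have ybad: "y $ j = 0" if j: "j < n" "bad (es ! j)" for j
  proof -
    have "j \<in> set J" using j by (simp add: J_def)
    then obtain r where r: "r < length J" "J ! r = j" by (auto simp: in_set_conv_nth)
    have "y = (mat_adjoint V * M) *\<^sub>v c"
      unfolding y_def x_def using assoc_mult_mat_vec[OF Va M c(1)] by simp
    moreover have "((mat_adjoint V * M) *\<^sub>v c) $ j = (Q *\<^sub>v c) $ r"
      using r j Jk M Vc c(1) by (simp add: Q_def scalar_prod_def)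
    ultimately show ?thesis using c(3) r Jk by simp
  qed
  have Vy: "V *\<^sub>v y = x"
    unfolding y_def using assoc_mult_mat_vec[OF Vc Va xc] VV xc by simp
  define D where "D = mat_diag n (\<lambda>i. es ! i)"
  have Dc: "D \<in> carrier_mat n n" by (simp add: D_def)
  have Dy: "(D *\<^sub>v y) $ j = es ! j * y $ j" if "j < n" for j
    using that yc by (simp add: D_def mat_diag_def scalar_prod_def if_distrib[of "\<lambda>x. x * _"] cong: if_cong)
  have Hx: "H *\<^sub>v x = V *\<^sub>v (D *\<^sub>v y)"
    unfolding Vy[symmetric] using Hc Vc Dc yc HV[folded D_def]
    by (metis assoc_mult_mat_vec)
  have DyC: "D *\<^sub>v y \<in> carrier_vec n" using mult_mat_vec_carrier[OF Dc yc] .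
  have "complex_of_real (sqnorm_vec (Z *\<^sub>v x)) = x \<bullet>c (H *\<^sub>v x)"
    unfolding sqnorm_vec_cscalar_prod H_def
    using adjoint_cscalar_prod[OF Z xc, of "Z *\<^sub>v x"] assoc_mult_mat_vec[OF Za Z xc]
      mult_mat_vec_carrier[OF Z xc] by simp
  also have "\<dots> = (V *\<^sub>v y) \<bullet>c (V *\<^sub>v (D *\<^sub>v y))" unfolding Hx Vy ..
  also have "\<dots> = y \<bullet>c (D *\<^sub>v y)"
    using adjoint_cscalar_prod[OF Vc yc, of "V *\<^sub>v (D *\<^sub>v y)"] assoc_mult_mat_vec[OF Va Vc DyC]
      mult_mat_vec_carrier[OF Vc DyC] DyC VV by simp
  also have "\<dots> = (\<Sum>j<n. y $ j * cnj (es ! j * y $ j))"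
    using yc carrier_matD[OF Dc] Dy by (simp add: scalar_prod_def atLeast0LessThan del: index_mult_mat_vec)
  finally have "sqnorm_vec (Z *\<^sub>v x) = Re (\<Sum>j<n. y $ j * cnj (es ! j * y $ j))"
    by (metis Re_complex_of_real)
  also have "\<dots> = (\<Sum>j<n. Re (es ! j) * (cmod (y $ j))\<^sup>2)"
    unfolding Re_sum by (intro sum.cong refl, simp only: cmod_power2) (simp add: algebra_simps power2_eq_square)
  also have "\<dots> \<le> (\<Sum>j<n. \<epsilon>\<^sup>2 * (cmod (y $ j))\<^sup>2)"
  proof (intro sum_mono)
    fix j assume j: "j \<in> {..<n}"
    show "Re (es ! j) * (cmod (y $ j))\<^sup>2 \<le> \<epsilon>\<^sup>2 * (cmod (y $ j))\<^sup>2"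
    proof (cases "bad (es ! j)")
      case False
      then have "0 \<le> Re (es ! j)" "sqrt (Re (es ! j)) < \<epsilon>" by (auto simp: bad_def)
      then have "Re (es ! j) \<le> \<epsilon>\<^sup>2"
        by (metis less_imp_le real_sqrt_le_iff real_sqrt_ge_zero order_trans power_mono real_sqrt_pow2)
      then show ?thesis by (intro mult_right_mono) auto
    qed (use ybad j in simp)
  qed
  also have "\<dots> = \<epsilon>\<^sup>2 * sqnorm_vec y"
    using yc by (simp add: sqnorm_vec_def sum_distrib_left)
  also have "sqnorm_vec y = sqnorm_vec x"
  proof -
    have "x \<bullet>c x = y \<bullet>c y"
      using adjoint_cscalar_prod[OF Vc yc xc] unfolding Vy y_def[symmetric] .
    then show ?thesis by (metis of_real_eq_iff sqnorm_vec_cscalar_prod)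
  qed
  finally show ?thesis using c unfolding x_def by blast
qed

section \<open>Inner products and orthonormal families\<close>

lemma cinner_zero_right [simp]: "cinner x (0::'a::complex_hilbert_space) = 0"
  using cinner_add_right[of x 0 0] by simp

lemma cinner_zero_left [simp]: "cinner (0::'a::complex_hilbert_space) x = 0"
  using cinner_commute[of 0 x] by simp

lemma cinner_add_left:
  "cinner (x + y) (z::'a::complex_hilbert_space) = cinner x z + cinner y z"
  by (metis cinner_add_right cinner_commute complex_cnj_add)

lemma cinner_scaleC_left:
  "cinner (c *\<^sub>C x) (z::'a::complex_hilbert_space) = cnj c * cinner x z"
  by (metis cinner_scaleC_right cinner_commute complex_cnj_mult)

lemma cinner_minus_right [simp]: "cinner x (- y::'a::complex_hilbert_space) = - cinner x y"
  using cinner_add_right[of x y "- y"] by (simp add: eq_neg_iff_add_eq_0 add.commute)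

lemma cinner_minus_left [simp]: "cinner (- x) (y::'a::complex_hilbert_space) = - cinner x y"
  by (metis cinner_minus_right cinner_commute complex_cnj_minus)

lemma cinner_diff_right: "cinner x (y - z::'a::complex_hilbert_space) = cinner x y - cinner x z"
  using cinner_add_right[of x y "- z"] by simp

lemma cinner_diff_left: "cinner (x - y) (z::'a::complex_hilbert_space) = cinner x z - cinner y z"
  using cinner_add_left[of x "- y" z] by simp

lemma cinner_sum_right:
  "cinner x (\<Sum>i\<in>I. f i :: 'a::complex_hilbert_space) = (\<Sum>i\<in>I. cinner x (f i))"
  by (induction I rule: infinite_finite_induct) (auto simp: cinner_add_right)

lemma cinner_sum_left:
  "cinner (\<Sum>i\<in>I. f i :: 'a::complex_hilbert_space) x = (\<Sum>i\<in>I. cinner (f i) x)"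
  by (induction I rule: infinite_finite_induct) (auto simp: cinner_add_left)

lemma cinner_self: "cinner x (x::'a::complex_hilbert_space) = complex_of_real ((norm x)\<^sup>2)"
proof (rule complex_eqI)
  show "Re (cinner x x) = Re (complex_of_real ((norm x)\<^sup>2))"
    by (simp add: Re_cinner power2_norm_eq_inner)
  show "Im (cinner x x) = Im (complex_of_real ((norm x)\<^sup>2))"
    using arg_cong[OF cinner_commute[of x x], of Im] by simp
qed

lemma norm_scaleC: "norm (c *\<^sub>C (x::'a::complex_hilbert_space)) = cmod c * norm x"
proof -
  have "complex_of_real ((norm (c *\<^sub>C x))\<^sup>2) = (c * cnj c) * complex_of_real ((norm x)\<^sup>2)"
    unfolding cinner_self[symmetric] cinner_scaleC_left cinner_scaleC_right by simp
  also have "\<dots> = complex_of_real ((cmod c * norm x)\<^sup>2)"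
    unfolding complex_norm_square[symmetric] by (simp add: power_mult_distrib)
  finally have "(norm (c *\<^sub>C x))\<^sup>2 = (cmod c * norm x)\<^sup>2"
    by (simp only: of_real_eq_iff)
  then show ?thesis by (simp add: power2_eq_iff_nonneg)
qed

text \<open>Rotating the second vector by a phase makes the inner product real and nonnegative, which
  reduces this to the real Cauchy--Schwarz inequality.\<close>

lemma cmod_cinner_le: "cmod (cinner x (y::'a::complex_hilbert_space)) \<le> norm x * norm y"
proof -
  define c where "c = cnj (sgn (cinner x y))"
  have "cmod (cinner x y) = Re (c * cinner x y)"
    by (cases "cinner x y = 0") (simp_all add: c_def sgn_div_norm scaleR_conv_of_real
        complex_norm_square[symmetric] power2_eq_square mult.commute divide_simps del: of_real_power)
  also have "\<dots> = inner x (c *\<^sub>C y)"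
    by (simp add: cinner_scaleC_right flip: Re_cinner)
  also have "\<dots> \<le> norm x * norm (c *\<^sub>C y)" by (rule norm_cauchy_schwarz)
  also have "\<dots> \<le> norm x * norm y"
    unfolding norm_scaleC
    by (intro mult_left_mono mult_left_le_one_le) (auto simp: c_def norm_sgn)
  finally show ?thesis .
qed

lemma tendsto_cinner_right:
  fixes f :: "'b \<Rightarrow> 'a::complex_hilbert_space"
  assumes "(f \<longlongrightarrow> l) F"
  shows "((\<lambda>d. cinner x (f d)) \<longlongrightarrow> cinner x l) F"
proof (rule Lim_null_comparison[THEN Lim_null[THEN iffD2]])
  show "\<forall>\<^sub>F d in F. norm (cinner x (f d) - cinner x l) \<le> norm x * norm (f d - l)"
    by (intro always_eventually allI) (metis cinner_diff_right cmod_cinner_le)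
  show "((\<lambda>d. norm x * norm (f d - l)) \<longlongrightarrow> 0) F"
    using tendsto_mult_right_zero[OF tendsto_norm_zero[OF assms[THEN Lim_null[THEN iffD1]]]] .
qed

definition orthonormal :: "nat \<Rightarrow> (nat \<Rightarrow> 'a::complex_hilbert_space) \<Rightarrow> bool" where
  "orthonormal n e \<longleftrightarrow> (\<forall>i<n. \<forall>j<n. cinner (e i) (e j) = (if i = j then 1 else 0))"

lemma cinner_orthonormal_sum:
  assumes "orthonormal n e" "i < n"
  shows "cinner (e i) (\<Sum>j<n. a j *\<^sub>C e j) = a i"
proof -
  have "cinner (e i) (\<Sum>j<n. a j *\<^sub>C e j) = (\<Sum>j<n. if i = j then a j else 0)"
    unfolding cinner_sum_right using assms
    by (intro sum.cong) (auto simp: cinner_scaleC_right orthonormal_def)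
  then show ?thesis using assms(2) by simp
qed

lemma norm_orthonormal_sum:
  assumes "orthonormal n e"
  shows "(norm (\<Sum>i<n. a i *\<^sub>C e i))\<^sup>2 = (\<Sum>i<n. (cmod (a i))\<^sup>2)"
proof -
  have "cinner (\<Sum>i<n. a i *\<^sub>C e i) (\<Sum>i<n. a i *\<^sub>C e i) = (\<Sum>i<n. cnj (a i) * a i)"
    by (subst (1) cinner_sum_left)
      (auto intro!: sum.cong simp: cinner_scaleC_left cinner_orthonormal_sum[OF assms])
  also have "\<dots> = complex_of_real (\<Sum>i<n. (cmod (a i))\<^sup>2)"
    by (simp add: complex_norm_square mult.commute del: of_real_power)
  finally show ?thesis unfolding cinner_self by (simp only: of_real_eq_iff)
qed

lemma bessel_inequality:
  assumes "orthonormal n e"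
  shows "(\<Sum>i<n. (cmod (cinner (e i) w))\<^sup>2) \<le> (norm w)\<^sup>2"
proof -
  define p where "p = (\<Sum>i<n. cinner (e i) w *\<^sub>C e i)"
  have "cinner p (w - p) = 0"
    unfolding p_def cinner_sum_left cinner_scaleC_left
    by (intro sum.neutral) (simp add: cinner_diff_right cinner_orthonormal_sum[OF assms])
  then have "inner p (w - p) = 0" by (metis Re_cinner zero_complex.sel(1))
  then have "(norm w)\<^sup>2 = (norm p)\<^sup>2 + (norm (w - p))\<^sup>2"
    by (simp add: power2_norm_eq_inner inner_diff_left inner_diff_right inner_commute)
  then show ?thesis
    using norm_orthonormal_sum[OF assms, of "\<lambda>i. cinner (e i) w"] by (simp add: p_def)
qed

lemma orthonormal_expansion:
  assumes "orthonormal n e" "x \<in> cvs.span (e ` {..<n})"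
  shows "x = (\<Sum>i<n. cinner (e i) x *\<^sub>C e i)"
  using assms(2)
proof (induction rule: cvs.span_induct_alt)
  case base then show ?case by simp
next
  case (step c u y)
  then obtain k where k: "u = e k" "k < n" by auto
  have "(\<Sum>i<n. cinner (e i) u *\<^sub>C e i) = (\<Sum>i<n. if i = k then e i else 0)"
    using assms(1) k by (intro sum.cong) (auto simp: orthonormal_def scaleC_one)
  then have "(\<Sum>i<n. cinner (e i) u *\<^sub>C e i) = u" using k by simp
  moreover have "(\<Sum>i<n. cinner (e i) (c *\<^sub>C u + y) *\<^sub>C e i) =
      c *\<^sub>C (\<Sum>i<n. cinner (e i) u *\<^sub>C e i) + (\<Sum>i<n. cinner (e i) y *\<^sub>C e i)"
    by (simp add: cinner_add_right cinner_scaleC_right scaleC_add_left scaleC_scaleC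
        sum.distrib cvs.scale_sum_right)
  ultimately show ?case using step.IH by simp
qed

section \<open>Operators with infinite-dimensional range\<close>

definition complex_linear :: "('a::complex_hilbert_space \<Rightarrow> 'a) \<Rightarrow> bool" where
  "complex_linear T \<longleftrightarrow> (\<forall>x y. T (x + y) = T x + T y) \<and> (\<forall>c x. T (c *\<^sub>C x) = c *\<^sub>C T x)"

lemma complex_linear_combination:
  assumes "complex_linear T"
  shows "T (\<Sum>i\<in>I. c i *\<^sub>C y i) = (\<Sum>i\<in>I. c i *\<^sub>C T (y i))"
proof -
  have "T 0 = 0" using assms unfolding complex_linear_def by (metis add_cancel_right_right)
  then show ?thesis using assms
    by (induction I rule: infinite_finite_induct) (auto simp: complex_linear_def)
qed

lemma complex_linear_bounded_op: "T \<in> bounded_ops \<Longrightarrow> complex_linear T"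
  by (auto simp: bounded_ops_def complex_linear_def bounded_linear.linear linear_add)

text \<open>The range is a subspace that is not spanned by the \<open>m\<close> images found so far, so it contains a
  vector outside their span; one Gram--Schmidt step, carried out on the preimages, adds it to the
  family.\<close>

lemma finite_rank_or_orthonormal_images:
  assumes T: "complex_linear T" and inf: "\<not> finite_rank T"
  shows "\<exists>y. orthonormal m (\<lambda>s. T (y s))"
proof (induction m)
  case 0 then show ?case by (simp add: orthonormal_def)
next
  case (Suc m)
  then obtain y where y: "orthonormal m (\<lambda>s. T (y s))" by blast
  have lin: "T (a + b) = T a + T b" "T (c *\<^sub>C a) = c *\<^sub>C T a" for a b c
    using T by (auto simp: complex_linear_def)
  have "T 0 = 0" using complex_linear_combination[OF T, of _ _ "{}"] by simp
  have sub: "cvs.subspace (range T)"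
  proof (rule cvs.subspaceI)
    show "0 \<in> range T" using \<open>T 0 = 0\<close> by (intro range_eqI[of _ _ 0]) simp
  next
    fix x y assume "x \<in> range T" "y \<in> range T"
    then obtain a b where "x = T a" "y = T b" by blast
    then show "x + y \<in> range T" by (intro range_eqI[of _ _ "a + b"]) (simp add: lin)
  next
    fix c x assume "x \<in> range T"
    then obtain a where "x = T a" by blast
    then show "c *\<^sub>C x \<in> range T" by (intro range_eqI[of _ _ "c *\<^sub>C a"]) (simp add: lin)
  qed
  define S where "S = cvs.span ((\<lambda>s. T (y s)) ` {..<m})"
  have "S \<subseteq> range T" unfolding S_def by (rule cvs.span_minimal[OF _ sub]) auto
  moreover have "range T \<noteq> S" using inf unfolding finite_rank_def S_def by blast
  ultimately obtain z where z: "T z \<notin> S" by blast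
  define w where "w = z - (\<Sum>s<m. cinner (T (y s)) (T z) *\<^sub>C y s)"
  have minus: "T (a - b) = T a - T b" for a b
    using lin(1)[of "a - b" b] by simp
  have Tw: "T w = T z - (\<Sum>s<m. cinner (T (y s)) (T z) *\<^sub>C T (y s))"
    unfolding w_def minus complex_linear_combination[OF T] ..
  have "(\<Sum>s<m. cinner (T (y s)) (T z) *\<^sub>C T (y s)) \<in> S"
    unfolding S_def by (intro cvs.span_sum cvs.span_scale cvs.span_base) auto
  with z have Tw0: "T w \<noteq> 0" unfolding Tw by auto
  have orth: "cinner (T (y s)) (T w) = 0" if "s < m" for s
    unfolding Tw cinner_diff_right using cinner_orthonormal_sum[OF y that] by simp
  then have orth': "cinner (T w) (T (y s)) = 0" if "s < m" for s
    using that by (metis cinner_commute complex_cnj_zero)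
  define r where "r = complex_of_real (1 / norm (T w))"
  have "norm (r *\<^sub>C T w) = 1"
    using Tw0 by (simp add: norm_scaleC r_def norm_divide)
  then have "cinner (r *\<^sub>C T w) (r *\<^sub>C T w) = 1"
    by (simp add: cinner_self)
  then have "orthonormal (Suc m) (\<lambda>s. T ((y(m := r *\<^sub>C w)) s))"
    using y orth orth'
    by (auto simp: orthonormal_def less_Suc_eq lin cinner_scaleC_left cinner_scaleC_right)
  then show ?case by blast
qed

section \<open>Weak limits of operators that are nearly of bounded rank\<close>

text \<open>If the operators \<open>R d\<close> nearly annihilate some unit combination of any \<open>m\<close> vectors, then the
  rank of a weak limit is less than \<open>m\<close>. The combination may depend on \<open>d\<close> in an uncontrolled
  way. This is harmless, because for \<open>w = (\<Sum>s<m. c s *\<^sub>C y s)\<close> the difference between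
  \<open>cinner (B w) (R d w)\<close> and \<open>cinner (B w) (B w)\<close> is bounded by the sum of the moduli of
  \<open>cinner (B (y s)) (R d (y t)) - cinner (B (y s)) (B (y t))\<close> over all \<open>s\<close> and \<open>t\<close>, whatever
  the coefficients of modulus at most 1 are, and this finite sum tends to 0.\<close>

lemma orthonormal_images_of_weak_limit:
  fixes R :: "'d \<Rightarrow> 'a::complex_hilbert_space \<Rightarrow> 'a"
  assumes F: "F \<noteq> bot" and B: "complex_linear B"
    and R: "\<And>d. complex_linear (R d)"
    and lim: "wot_tendsto R B F"
    and small: "\<And>\<epsilon> y. \<epsilon> > 0 \<Longrightarrow> \<forall>\<^sub>F d in F. \<exists>c. (\<Sum>s<m. (cmod (c s))\<^sup>2) = 1 \<and>
       norm (R d (\<Sum>s<m. c s *\<^sub>C y s)) \<le> \<epsilon> * norm (\<Sum>s<m. c s *\<^sub>C y s)"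
  shows "\<not> orthonormal m (\<lambda>s. B (y s))"
proof
  assume on: "orthonormal m (\<lambda>s. B (y s))"
  \<comment> \<open>\<open>K\<close> bounds the norm of every unit combination of the \<open>y s\<close>; the summand 1 makes it
    positive. With \<open>\<epsilon> = 1 / (4 * K)\<close> and the sum of all moduli of \<open>\<Delta> d s t\<close> below \<open>1 / 2\<close>, the number
    \<open>cinner (B w) (B w) = 1\<close> would be at most \<open>1 / 4 + 1 / 2\<close>.\<close>
  define K where "K = 1 + (\<Sum>s<m. norm (y s))"
  have K: "K \<ge> 1" by (simp add: K_def sum_nonneg)
  define \<Delta> where "\<Delta> d s t = cinner (B (y s)) (R d (y t)) - cinner (B (y s)) (B (y t))" for d s t
  have "((\<lambda>d. \<Sum>s<m. \<Sum>t<m. cmod (\<Delta> d s t)) \<longlongrightarrow> (\<Sum>s<m. \<Sum>t<m. 0)) F"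
    unfolding \<Delta>_def using lim unfolding wot_tendsto_def
    by (intro tendsto_sum tendsto_norm_zero Lim_null[THEN iffD1]) auto
  then have "((\<lambda>d. \<Sum>s<m. \<Sum>t<m. cmod (\<Delta> d s t)) \<longlongrightarrow> 0) F" by simp
  then have "\<forall>\<^sub>F d in F. (\<Sum>s<m. \<Sum>t<m. cmod (\<Delta> d s t)) < 1/2"
    by (rule order_tendstoD) simp
  moreover have "\<forall>\<^sub>F d in F. \<exists>c. (\<Sum>s<m. (cmod (c s))\<^sup>2) = 1 \<and>
       norm (R d (\<Sum>s<m. c s *\<^sub>C y s)) \<le> 1 / (4 * K) * norm (\<Sum>s<m. c s *\<^sub>C y s)"
    using K by (intro small) auto
  ultimately have "\<forall>\<^sub>F d in F. False"
  proof eventually_elim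
    case (elim d)
    then obtain c where c: "(\<Sum>s<m. (cmod (c s))\<^sup>2) = 1"
      and le: "norm (R d (\<Sum>s<m. c s *\<^sub>C y s)) \<le> 1 / (4 * K) * norm (\<Sum>s<m. c s *\<^sub>C y s)" by blast
    define w where "w = (\<Sum>s<m. c s *\<^sub>C y s)"
    have c1: "cmod (c s) \<le> 1" if "s < m" for s
    proof -
      have "(cmod (c s))\<^sup>2 \<le> (\<Sum>s<m. (cmod (c s))\<^sup>2)"
        using that by (intro member_le_sum) auto
      then show ?thesis unfolding c by (simp add: power2_le_iff_abs_le abs_square_le_1)
    qed
    have "norm w \<le> (\<Sum>s<m. norm (c s *\<^sub>C y s))" unfolding w_def by (rule norm_sum)
    also have "\<dots> \<le> (\<Sum>s<m. norm (y s))"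
      unfolding norm_scaleC by (intro sum_mono mult_left_le_one_le) (auto simp: c1)
    finally have "norm w \<le> K" by (simp add: K_def)
    then have "1 / (4 * K) * norm w \<le> 1 / (4 * K) * K" using K by (intro mult_left_mono) auto
    moreover have "norm (R d w) \<le> 1 / (4 * K) * norm w" using le by (simp only: w_def)
    ultimately have "norm (R d w) \<le> 1 / (4 * K) * K" by linarith
    then have Rw: "norm (R d w) \<le> 1 / 4" using K by simp
    have Bw: "B w = (\<Sum>s<m. c s *\<^sub>C B (y s))"
      unfolding w_def by (rule complex_linear_combination[OF B])
    have nB: "norm (B w) = 1"
      using norm_orthonormal_sum[OF on, of c] c by (simp add: Bw abs_square_eq_1)
    have expand: "cinner (B w) (T w) = (\<Sum>s<m. \<Sum>t<m. cnj (c s) * c t * cinner (B (y s)) (T (y t)))"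
      if "complex_linear T" for T
      unfolding Bw unfolding w_def complex_linear_combination[OF that] cinner_sum_left
      by (simp add: cinner_sum_right cinner_scaleC_left cinner_scaleC_right sum_distrib_left mult_ac)
    have "cinner (B w) (R d w) - cinner (B w) (B w) = (\<Sum>s<m. \<Sum>t<m. cnj (c s) * c t * \<Delta> d s t)"
      unfolding expand[OF R] expand[OF B] \<Delta>_def by (simp add: sum_subtractf algebra_simps)
    also have "cmod \<dots> \<le> (\<Sum>s<m. \<Sum>t<m. cmod (cnj (c s) * c t * \<Delta> d s t))"
      by (intro sum_norm_le order_refl)
    also have "\<dots> \<le> (\<Sum>s<m. \<Sum>t<m. cmod (\<Delta> d s t))"
      using c1 by (intro sum_mono) (auto simp: norm_mult intro!: mult_left_le_one_le mult_le_one)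
    finally have "cmod (cinner (B w) (R d w) - cinner (B w) (B w)) < 1 / 2" using elim(1) by linarith
    moreover have "cmod (cinner (B w) (R d w)) \<le> 1 / 4"
      using cmod_cinner_le[of "B w" "R d w"] Rw nB by simp
    moreover have "cmod (cinner (B w) (B w)) = 1" by (simp add: cinner_self nB)
    ultimately show False
      using norm_triangle_ineq2[of "cinner (B w) (B w)" "cinner (B w) (R d w)"]
      by (simp add: norm_minus_commute)
  qed
  then show False using F by (simp add: eventually_False)
qed

section \<open>Subnets and compressions\<close>

lemma eventually_net_filter:
  assumes "directed_set D leq"
  shows "eventually Q (net_filter D leq) \<longleftrightarrow> (\<exists>a\<in>D. \<forall>b\<in>D. leq a b \<longrightarrow> Q b)"
proof -
  have "eventually Q (INF a\<in>D. principal {b \<in> D. leq a b}) \<longleftrightarrow>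
      (\<exists>a\<in>D. eventually Q (principal {b \<in> D. leq a b}))"
  proof (rule eventually_INF_base)
    show "D \<noteq> {}" using assms by (simp add: directed_set_def)
  next
    fix a b assume ab: "a \<in> D" "b \<in> D"
    obtain x where x: "x \<in> D" "leq a x" "leq b x" using assms ab unfolding directed_set_def by blast
    have "leq a c" if "leq a x" "leq x c" "a \<in> D" "c \<in> D" for a c
      using that x(1) assms unfolding directed_set_def by blast
    then have "{c \<in> D. leq x c} \<subseteq> {c \<in> D. leq a c} \<inter> {c \<in> D. leq b c}"
      using x ab by blast
    then have "principal {c \<in> D. leq x c} \<le> inf (principal {c \<in> D. leq a c}) (principal {c \<in> D. leq b c})"
      by (simp only: inf_principal principal_le_iff)
    with x(1) show "\<exists>x\<in>D. principal {c \<in> D. leq x c} \<le>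
        inf (principal {c \<in> D. leq a c}) (principal {c \<in> D. leq b c})" by blast
  qed
  then show ?thesis by (simp add: net_filter_def eventually_principal Ball_def imp_conjL)
qed

lemma subnet_of_sequence_filter:
  assumes "subnet_of_sequence D leq h"
  shows "net_filter D leq \<noteq> bot" "filterlim h sequentially (net_filter D leq)"
proof -
  have D: "directed_set D leq" using assms by (simp add: subnet_of_sequence_def)
  then have "D \<noteq> {}" "\<forall>a\<in>D. leq a a" unfolding directed_set_def by blast+
  then have "\<not> eventually (\<lambda>_. False) (net_filter D leq)"
    unfolding eventually_net_filter[OF D] by blast
  then show "net_filter D leq \<noteq> bot" by (auto simp: trivial_limit_def)
  show "filterlim h sequentially (net_filter D leq)"
    unfolding filterlim_at_top eventually_net_filter[OF D]
    using assms unfolding subnet_of_sequence_def by blast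
qed

lemma orthogonal_projection_norm_le:
  assumes "orthogonal_projection P"
  shows "norm (P x) \<le> norm x"
proof -
  have "cinner (P x) (P x) = cinner x (P (P x))"
    using assms by (simp add: orthogonal_projection_def self_adjoint_def)
  also have "P (P x) = P x" using assms unfolding orthogonal_projection_def by (metis comp_apply)
  finally have "(norm (P x))\<^sup>2 = inner x (P x)"
    using Re_cinner by (metis power2_norm_eq_inner)
  also have "\<dots> \<le> norm x * norm (P x)" by (rule norm_cauchy_schwarz)
  finally show ?thesis
    by (cases "norm (P x) = 0") (auto simp: power2_eq_square)
qed

text \<open>The matrix of \<open>P A P\<close> in an orthonormal basis of the range of \<open>P\<close> represents \<open>P A P\<close> on the
  whole space: inserting the coordinates of \<open>x\<close> amounts to projecting \<open>x\<close>, because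
  \<open>cinner (e j) (P x) = cinner (e j) x\<close>.\<close>

lemma op_of_mat_section_mat:
  assumes P: "orthogonal_projection P" and e: "onb_of n e (range P)" and A: "A \<in> bounded_ops"
  shows "op_of_mat n e (section_mat P n e A) x = P (A (P x))"
proof -
  have on: "orthonormal n e" and sp: "cvs.span (e ` {..<n}) = range P"
    using e by (auto simp: onb_of_def orthonormal_def)
  have PP: "P (P y) = P y" for y using P unfolding orthogonal_projection_def by (metis comp_apply)
  have Pe: "P (e j) = e j" if "j < n" for j
  proof -
    have "e j \<in> range P" unfolding sp[symmetric] using that by (intro cvs.span_base) auto
    then show ?thesis using PP by auto
  qed
  have sa: "cinner (e j) (P y) = cinner (e j) y" if "j < n" for j y
    using P Pe[OF that] unfolding orthogonal_projection_def self_adjoint_def by metis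
  have expand: "P y = (\<Sum>j<n. cinner (e j) y *\<^sub>C e j)" for y
  proof -
    have "P y = (\<Sum>j<n. cinner (e j) (P y) *\<^sub>C e j)"
      by (rule orthonormal_expansion[OF on]) (simp add: sp)
    also have "\<dots> = (\<Sum>j<n. cinner (e j) y *\<^sub>C e j)"
      by (intro sum.cong) (auto simp: sa)
    finally show ?thesis .
  qed
  have lin: "complex_linear A" using A by (rule complex_linear_bounded_op)
  have "op_of_mat n e (section_mat P n e A) x =
      (\<Sum>i<n. (\<Sum>j<n. cinner (e i) (A (e j)) * cinner (e j) x) *\<^sub>C e i)"
    unfolding op_of_mat_def section_mat_def mat_of_op_def cvs.scale_sum_left
    by (intro sum.cong refl) (simp add: Pe sa)
  also have "\<dots> = (\<Sum>i<n. cinner (e i) (A (P x)) *\<^sub>C e i)"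
    unfolding expand[of x] complex_linear_combination[OF lin] cinner_sum_right
    by (simp add: cinner_scaleC_right mult.commute)
  finally show ?thesis unfolding expand[of "A (P x)"] .
qed

text \<open>Contractivity of the projections bounds \<open>P n (A (P n x)) - P n (A x)\<close> by the norm of
  \<open>A (P n x) - A x\<close>.\<close>

lemma compression_tendsto:
  assumes P: "\<And>n. orthogonal_projection (P n)" and lim: "\<And>x. (\<lambda>n. P n x) \<longlonglongrightarrow> x"
    and A: "A \<in> bounded_ops"
  shows "(\<lambda>n. P n (A (P n x))) \<longlonglongrightarrow> A x"
proof -
  have "(\<lambda>n. A (P n x)) \<longlonglongrightarrow> A x"
    using A by (intro bounded_linear.tendsto[OF _ lim]) (simp add: bounded_ops_def)
  then have lim0: "(\<lambda>n. norm (A (P n x) - A x)) \<longlonglongrightarrow> 0"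
    by (intro tendsto_norm_zero Lim_null[THEN iffD1])
  have le: "norm (P n (A (P n x)) - P n (A x)) \<le> norm (A (P n x) - A x)" for n
  proof -
    have "bounded_linear (P n)" using P[of n] by (simp add: orthogonal_projection_def bounded_ops_def)
    then have "P n (A (P n x)) - P n (A x) = P n (A (P n x) - A x)"
      by (simp add: bounded_linear.linear linear_diff)
    then show ?thesis using orthogonal_projection_norm_le[OF P] by simp
  qed
  have "(\<lambda>n. P n (A (P n x)) - P n (A x)) \<longlonglongrightarrow> 0"
    by (rule Lim_null_comparison[OF _ lim0]) (intro always_eventually allI le)
  from tendsto_add[OF this lim[of "A x"]] show ?thesis by simp
qed

section \<open>The uniform cluster condition in terms of operators\<close>

lemma complex_linear_op_of_mat: "complex_linear (op_of_mat n e Z)"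
  unfolding complex_linear_def op_of_mat_def
  by (simp add: cinner_add_right cinner_scaleC_right scaleC_add_left scaleC_scaleC sum.distrib
      cvs.scale_sum_right distrib_left mult_ac)

text \<open>Passing to coordinates turns the claim into \<open>exists_small_combination\<close> for the matrix whose
  columns are the coordinate vectors of the \<open>y s\<close>. By Bessel's inequality the coordinate vector of
  the combination is no longer than the combination, which need not lie in the span of the basis. The coefficients are
  normalised at the end.\<close>

lemma op_of_mat_small_combination:
  assumes e: "orthonormal n e" and Z: "Z \<in> carrier_mat n n" and \<epsilon>: "\<epsilon> \<ge> 0"
    and few: "size (filter_mset (\<lambda>s. s \<notin> {0..<\<epsilon>}) (singular_values Z)) < k"
  shows "\<exists>c. (\<Sum>s<k. (cmod (c s))\<^sup>2) = 1 \<and>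
    norm (op_of_mat n e Z (\<Sum>s<k. c s *\<^sub>C y s)) \<le> \<epsilon> * norm (\<Sum>s<k. c s *\<^sub>C y s)"
proof -
  define M where "M = mat n k (\<lambda>(r,s). cinner (e r) (y s))"
  have M: "M \<in> carrier_mat n k" by (simp add: M_def)
  obtain c where c: "c \<in> carrier_vec k" "c \<noteq> 0\<^sub>v k"
    and le: "sqnorm_vec (Z *\<^sub>v (M *\<^sub>v c)) \<le> \<epsilon>\<^sup>2 * sqnorm_vec (M *\<^sub>v c)"
    using exists_small_combination[OF Z M few] by blast
  define w where "w = (\<Sum>s<k. c $ s *\<^sub>C y s)"
  have coords: "(M *\<^sub>v c) $ j = cinner (e j) w" if "j < n" for j
    using that c(1) unfolding w_def cinner_sum_right
    by (simp add: M_def scalar_prod_def atLeast0LessThan cinner_scaleC_right mult.commute)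
  have "op_of_mat n e Z w = (\<Sum>i<n. (Z *\<^sub>v (M *\<^sub>v c)) $ i *\<^sub>C e i)"
    unfolding op_of_mat_def cvs.scale_sum_left[symmetric]
  proof (intro sum.cong refl arg_cong[where f = "\<lambda>z. z *\<^sub>C _"])
    fix i assume "i \<in> {..<n}"
    then have "(Z *\<^sub>v (M *\<^sub>v c)) $ i = (\<Sum>j<n. Z $$ (i,j) * (M *\<^sub>v c) $ j)"
      using Z M by (simp add: scalar_prod_def atLeast0LessThan)
    then show "(\<Sum>j<n. Z $$ (i,j) * cinner (e j) w) = (Z *\<^sub>v (M *\<^sub>v c)) $ i"
      using coords by simp
  qed
  then have "(norm (op_of_mat n e Z w))\<^sup>2 = sqnorm_vec (Z *\<^sub>v (M *\<^sub>v c))"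
    using norm_orthonormal_sum[OF e] Z by (simp add: sqnorm_vec_def)
  also have "\<dots> \<le> \<epsilon>\<^sup>2 * sqnorm_vec (M *\<^sub>v c)" by (rule le)
  also have "sqnorm_vec (M *\<^sub>v c) = (\<Sum>j<n. (cmod (cinner (e j) w))\<^sup>2)"
    unfolding sqnorm_vec_def using M coords by (intro sum.cong) auto
  also have "\<epsilon>\<^sup>2 * \<dots> \<le> \<epsilon>\<^sup>2 * (norm w)\<^sup>2"
    by (intro mult_left_mono bessel_inequality[OF e]) simp
  finally have "(norm (op_of_mat n e Z w))\<^sup>2 \<le> (\<epsilon> * norm w)\<^sup>2"
    by (simp add: power_mult_distrib)
  then have nw: "norm (op_of_mat n e Z w) \<le> \<epsilon> * norm w"
    by (rule power2_le_imp_le) (simp add: \<epsilon>)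
  have "sqnorm_vec c > 0"
    using c sqnorm_vec_eq_0[OF c(1)] sqnorm_vec_nonneg[of c] by linarith
  define r where "r = 1 / sqrt (sqnorm_vec c)"
  have r: "r > 0" "r\<^sup>2 * sqnorm_vec c = 1"
    using \<open>sqnorm_vec c > 0\<close> by (auto simp: r_def power_divide)
  define c' where "c' s = complex_of_real r * c $ s" for s
  have "(\<Sum>s<k. (cmod (c' s))\<^sup>2) = r\<^sup>2 * sqnorm_vec c"
    using c(1) r(1) by (simp add: c'_def sqnorm_vec_def norm_mult power_mult_distrib sum_distrib_left)
  moreover have w': "(\<Sum>s<k. c' s *\<^sub>C y s) = complex_of_real r *\<^sub>C w"
    by (simp add: c'_def w_def cvs.scale_sum_right scaleC_scaleC)
  moreover have "norm (op_of_mat n e Z (complex_of_real r *\<^sub>C w)) = r * norm (op_of_mat n e Z w)"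
    using complex_linear_op_of_mat[of n e Z] r(1) by (simp add: complex_linear_def norm_scaleC)
  moreover have "r * norm (op_of_mat n e Z w) \<le> r * (\<epsilon> * norm w)"
    using nw r(1) by (intro mult_left_mono) auto
  ultimately show ?thesis
    using r by (intro exI[of _ c']) (simp add: norm_scaleC mult.left_commute)
qed

section \<open>Finite rank of the difference\<close>

theorem theorem4p1:
  fixes P :: "nat \<Rightarrow> 'a::complex_hilbert_space \<Rightarrow> 'a"
    and e :: "nat \<Rightarrow> nat \<Rightarrow> 'a"
    and U :: "nat \<Rightarrow> complex mat"
    and A :: "'a \<Rightarrow> 'a"
    and \<Phi> :: "('a \<Rightarrow> 'a) \<Rightarrow> ('a \<Rightarrow> 'a)"
    and D :: "'d set" and leq :: "'d \<Rightarrow> 'd \<Rightarrow> bool" and h :: "'d \<Rightarrow> nat"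
  assumes "separable_space (euclidean :: 'a topology)"
    and "\<And>n. orthogonal_projection (P n)"
    and "\<And>n. cvs.dim (range (P n)) = n"
    and "\<And>n. onb_of n (e n) (range (P n))"
    and "\<And>x. (\<lambda>n. P n x) \<longlonglongrightarrow> x"
    and "\<And>n. unitary_mat n (U n)"
    and "subnet_of_sequence D leq h"
    and "bw_tendsto (\<lambda>d. approx_map P e U (h d)) \<Phi> (net_filter D leq)"
    and "A \<in> bounded_ops" and "self_adjoint A"
    and "uniform_cluster (\<lambda>n. optimal_approx (U n) (section_mat (P n) n (e n) A))
           (\<lambda>n. section_mat (P n) n (e n) A)"
  shows "finite_rank (\<lambda>x. A x - \<Phi> A x)"
proof (rule ccontr)
  assume infinite: "\<not> finite_rank (\<lambda>x. A x - \<Phi> A x)"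
  define X where "X n = optimal_approx (U n) (section_mat (P n) n (e n) A)" for n
  define Y where "Y n = section_mat (P n) n (e n) A" for n
  define F where "F = net_filter D leq"
  define R where "R d = op_of_mat (h d) (e (h d)) (X (h d) - Y (h d))" for d
  define B where "B x = \<Phi> A x - A x" for x
  have e: "orthonormal n (e n)" for n
    using assms(4)[of n] by (simp add: onb_of_def orthonormal_def)
  have Y: "Y n \<in> carrier_mat n n" for n by (simp add: Y_def section_mat_def mat_of_op_def)
  have X: "X n \<in> carrier_mat n n" for n
    using optimal_approx_explicit(1,3)[OF assms(6) Y[of n]] assms(6)[of n]
    by (auto simp: X_def Y_def diagonalized_by_def unitary_mat_def)
  have XY: "X n - Y n \<in> carrier_mat n n" for n using minus_carrier_mat[OF Y] .
  note F = subnet_of_sequence_filter[OF assms(7), folded F_def]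
  obtain N where N: "\<And>\<epsilon>. \<epsilon> > 0 \<Longrightarrow> \<exists>N2. \<forall>n>N2.
      size (filter_mset (\<lambda>s. s \<notin> {0..<\<epsilon>}) (singular_values (X n - Y n))) \<le> N"
    using assms(11) unfolding uniform_cluster_def X_def Y_def by blast
  have "\<Phi> A \<in> bounded_ops"
    using assms(8,9) by (auto simp: bw_tendsto_def cp_maps_def completely_positive_def)
  then have lin: "complex_linear A" "complex_linear (\<Phi> A)"
    using assms(9) by (auto intro: complex_linear_bounded_op)
  then have linB: "complex_linear B" "complex_linear (\<lambda>x. A x - \<Phi> A x)"
    by (auto simp: complex_linear_def B_def cvs.scale_right_diff_distrib)
  have R: "cinner x (R d z) = cinner x (approx_map P e U (h d) A z) - cinner x (P (h d) (A (P (h d) z)))"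
    for x d z
  proof -
    have "op_of_mat n (e n) (X n - Y n) z = op_of_mat n (e n) (X n) z - op_of_mat n (e n) (Y n) z" for n
      unfolding op_of_mat_def sum_subtractf[symmetric] cvs.scale_left_diff_distrib[symmetric]
      using X[of n] Y[of n] by (intro sum.cong refl) (simp add: left_diff_distrib)
    then show ?thesis
      using op_of_mat_section_mat[OF assms(2,4,9)]
      by (simp add: R_def approx_map_def X_def Y_def cinner_diff_right)
  qed
  have "wot_tendsto R B F"
    unfolding wot_tendsto_def R B_def cinner_diff_right
  proof (intro allI tendsto_diff)
    fix x z
    show "((\<lambda>d. cinner x (approx_map P e U (h d) A z)) \<longlongrightarrow> cinner x (\<Phi> A z)) F"
      using assms(8,9) by (simp add: bw_tendsto_def wot_tendsto_def F_def)
    show "((\<lambda>d. cinner x (P (h d) (A (P (h d) z)))) \<longlongrightarrow> cinner x (A z)) F"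
      using tendsto_cinner_right[OF filterlim_compose[OF compression_tendsto[OF assms(2,5,9)] F(2)]] .
  qed
  moreover have "\<forall>\<^sub>F d in F. \<exists>c. (\<Sum>s<Suc N. (cmod (c s))\<^sup>2) = 1 \<and>
      norm (R d (\<Sum>s<Suc N. c s *\<^sub>C y s)) \<le> \<epsilon> * norm (\<Sum>s<Suc N. c s *\<^sub>C y s)"
    if \<epsilon>: "\<epsilon> > 0" for \<epsilon> and y :: "nat \<Rightarrow> 'a"
  proof -
    obtain N2 where N2: "\<And>n. n > N2 \<Longrightarrow>
        size (filter_mset (\<lambda>s. s \<notin> {0..<\<epsilon>}) (singular_values (X n - Y n))) \<le> N"
      using N[OF \<epsilon>] by blast
    have "\<forall>\<^sub>F d in F. h d > N2"
      using F(2)[unfolded filterlim_at_top, rule_format, of "Suc N2"] by (simp add: Suc_le_eq)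
    then show ?thesis
    proof eventually_elim
      case (elim d)
      show ?case
        unfolding R_def using \<epsilon> N2[OF elim]
        by (intro op_of_mat_small_combination[OF e XY]) auto
    qed
  qed
  ultimately have "\<not> orthonormal (Suc N) (\<lambda>s. B (y s))" for y
    by (intro orthonormal_images_of_weak_limit[OF F(1) linB(1), of R])
      (simp_all only: R_def complex_linear_op_of_mat)
  moreover obtain y where "orthonormal (Suc N) (\<lambda>s. A (y s) - \<Phi> A (y s))"
    using finite_rank_or_orthonormal_images[OF linB(2) infinite] by blast
  then have "orthonormal (Suc N) (\<lambda>s. - B (y s))" by (simp add: B_def)
  then have "orthonormal (Suc N) (\<lambda>s. B (y s))" by (simp add: orthonormal_def)
  ultimately show False by blast
qed

end
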